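(* Let $B$ be an Alexandroff space and let $p\colon E\to B$ be a fiber bundle over $B$. Then $p$ is a Hurewicz fibration.
   Context: An Alexandroff space is a topological space in which arbitrary intersections of open sets are open. A fiber bundle over $B$ (with fiber a topological space $F$) is a continuous map $p\colon E\to B$ such that every $b\in B$ has an open neighbourhood $U$ with a homeomorphism $p^{-1}(U)\to U\times F$ commuting with the maps to $U$. A Hurewicz fibration is a continuous map with the homotopy lifting property with respect to all topological spaces. *)

theory Defs
  imports "HOL-Analysis.Analysis"
begin

text \<open>Intersecting with \<^term>\<open>topspace B\<close> only matters for the empty family, where
  \<^term>\<open>\<Inter>{}\<close> would be the whole type.\<close>

definition alexandroff_space :: "'b topology \<Rightarrow> bool" where
  "alexandroff_space B \<longleftrightarrow>
    (\<forall>\<U>. (\<forall>U\<in>\<U>. openin B U) \<longrightarrow> openin B (topspace B \<inter> \<Inter>\<U>))"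

definition fiber_bundle ::
  "'f topology \<Rightarrow> 'e topology \<Rightarrow> 'b topology \<Rightarrow> ('e \<Rightarrow> 'b) \<Rightarrow> bool" where
  "fiber_bundle F E B p \<longleftrightarrow>
    continuous_map E B p \<and>
    (\<forall>b\<in>topspace B. \<exists>U h. openin B U \<and> b \<in> U \<and>
      homeomorphic_map (subtopology E {e \<in> topspace E. p e \<in> U})
        (prod_topology (subtopology B U) F) h \<and>
      (\<forall>e\<in>topspace E. p e \<in> U \<longrightarrow> fst (h e) = p e))"

text \<open>As in \<^const>\<open>homotopic_with\<close>, the interval is the first factor of the domain of a homotopy.\<close>

definition homotopy_lifting_property ::
  "'x topology \<Rightarrow> 'e topology \<Rightarrow> 'b topology \<Rightarrow> ('e \<Rightarrow> 'b) \<Rightarrow> bool" where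
  "homotopy_lifting_property X E B p \<longleftrightarrow>
    (\<forall>H f. continuous_map (prod_topology (top_of_set {0..1::real}) X) B H \<and>
           continuous_map X E f \<and>
           (\<forall>x\<in>topspace X. p (f x) = H (0, x)) \<longrightarrow>
      (\<exists>K. continuous_map (prod_topology (top_of_set {0..1::real}) X) E K \<and>
           (\<forall>t\<in>{0..1}. \<forall>x\<in>topspace X. p (K (t, x)) = H (t, x)) \<and>
           (\<forall>x\<in>topspace X. K (0, x) = f x)))"

text \<open>HOL cannot quantify over types inside a definition, so the type carrying the test spaces
  is a parameter. A map is a Hurewicz fibration iff this predicate holds for every type
  \<^typ>\<open>'x\<close>; theorems should leave \<^typ>\<open>'x\<close> as a free type variable.\<close>

definition hurewicz_fibration ::
  "'x itself \<Rightarrow> 'e topology \<Rightarrow> 'b topology \<Rightarrow> ('e \<Rightarrow> 'b) \<Rightarrow> bool" where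
  "hurewicz_fibration T E B p \<longleftrightarrow>
    continuous_map E B p \<and>
    (\<forall>X::'x topology. homotopy_lifting_property X E B p)"

end

theory Submission
  imports Defs
begin

text \<open>Over the minimal open neighbourhood of a point the bundle is trivial, and a transition map
  between two such trivialisations, being continuous on a set all of whose points specialise to
  its centre, does not depend on the base point up to topological indistinguishability in the
  fibre. So the bundle is flat up to indistinguishability. Every path in the base then has a
  horizontal lift, i.e. one whose fibre coordinate is locally constant up to indistinguishability.
  Choosing such a lift separately for each point of the test space yields a lifted homotopy; its
  continuity propagates along the interval because continuity does not see indistinguishable
  points.\<close>

section \<open>Specialization and topological indistinguishability\<close>

text \<open>Orientation: \<open>x\<close> lies in the closure of \<open>y\<close>. For an
  Alexandroff base the points related to \<open>b\<close> in this way are exactly those of the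
  minimal open neighbourhood of \<open>b\<close>.\<close>

definition specializes :: "'a topology \<Rightarrow> 'a \<Rightarrow> 'a \<Rightarrow> bool" where
  "specializes X x y \<longleftrightarrow> x \<in> topspace X \<and> y \<in> topspace X \<and> (\<forall>U. openin X U \<longrightarrow> x \<in> U \<longrightarrow> y \<in> U)"

definition indistinguishable :: "'a topology \<Rightarrow> 'a \<Rightarrow> 'a \<Rightarrow> bool" where
  "indistinguishable X x y \<longleftrightarrow> specializes X x y \<and> specializes X y x"

lemma specializes_topspace: "specializes X x y \<Longrightarrow> x \<in> topspace X \<and> y \<in> topspace X"
  by (simp add: specializes_def)

lemma specializesD: "specializes X x y \<Longrightarrow> openin X U \<Longrightarrow> x \<in> U \<Longrightarrow> y \<in> U"
  by (simp add: specializes_def)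

lemma specializes_refl: "x \<in> topspace X \<Longrightarrow> specializes X x x"
  by (simp add: specializes_def)

lemma specializes_trans: "specializes X x y \<Longrightarrow> specializes X y z \<Longrightarrow> specializes X x z"
  by (simp add: specializes_def)

lemma indistinguishable_refl: "x \<in> topspace X \<Longrightarrow> indistinguishable X x x"
  by (simp add: indistinguishable_def specializes_refl)

lemma indistinguishable_sym: "indistinguishable X x y \<Longrightarrow> indistinguishable X y x"
  by (simp add: indistinguishable_def)

lemma indistinguishable_trans:
  "indistinguishable X x y \<Longrightarrow> indistinguishable X y z \<Longrightarrow> indistinguishable X x z"
  by (meson indistinguishable_def specializes_trans)

lemma specializes_continuous_map:
  assumes "continuous_map X Y f" "specializes X x y"
  shows "specializes Y (f x) (f y)"
  unfolding specializes_def
proof (intro conjI allI impI)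
  show "f x \<in> topspace Y" "f y \<in> topspace Y"
    using specializes_topspace[OF assms(2)] assms(1) by (auto simp: continuous_map_def)
  fix U assume "openin Y U" "f x \<in> U"
  then show "f y \<in> U"
    using specializesD[OF assms(2) openin_continuous_map_preimage[OF assms(1)], of U]
      specializes_topspace[OF assms(2)] by simp
qed

lemma openin_prod_topology_box:
  assumes "openin (prod_topology X Y) W" "(x, y) \<in> W"
  obtains U V where "openin X U" "openin Y V" "x \<in> U" "y \<in> V" "U \<times> V \<subseteq> W"
  using assms by (metis openin_prod_topology_alt)

lemma specializes_prod_topology:
  assumes "specializes X a a'" "specializes Y b b'"
  shows "specializes (prod_topology X Y) (a, b) (a', b')"
  unfolding specializes_def
proof (intro conjI allI impI)
  show "(a, b) \<in> topspace (prod_topology X Y)" "(a', b') \<in> topspace (prod_topology X Y)"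
    using assms[THEN specializes_topspace] by simp_all
  fix U assume "openin (prod_topology X Y) U" "(a, b) \<in> U"
  then obtain V W where "openin X V" "openin Y W" "a \<in> V" "b \<in> W" "V \<times> W \<subseteq> U"
    by (rule openin_prod_topology_box)
  moreover from this have "a' \<in> V" "b' \<in> W"
    using assms specializesD by fast+
  ultimately show "(a', b') \<in> U" by blast
qed

lemma specializes_subtopology:
  assumes "specializes X x y" "x \<in> S" "y \<in> S"
  shows "specializes (subtopology X S) x y"
  using specializes_topspace[OF assms(1)] specializesD[OF assms(1)] assms(2,3)
  by (auto simp: specializes_def openin_subtopology)

text \<open>An open set contains both or neither of two indistinguishable points, so
  \<open>f\<close> and \<open>g\<close> have the same preimages of open sets. This later replaces a
  lift chosen pointwise by a map that is visibly continuous.\<close>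

lemma continuous_map_indistinguishable:
  assumes f: "continuous_map X Y f"
    and ind: "\<And>x. x \<in> topspace X \<Longrightarrow> indistinguishable Y (f x) (g x)"
  shows "continuous_map X Y g"
  unfolding continuous_map_def
proof (intro conjI allI impI)
  show "g \<in> topspace X \<rightarrow> topspace Y"
    using ind specializes_topspace unfolding indistinguishable_def by fast
  fix U assume U: "openin Y U"
  then have "{x \<in> topspace X. g x \<in> U} = {x \<in> topspace X. f x \<in> U}"
    using ind specializesD[OF _ U] unfolding indistinguishable_def by blast
  then show "openin X {x \<in> topspace X. g x \<in> U}"
    using f U by (simp add: continuous_map_def)
qed

lemma continuous_map_local:
  assumes "\<And>x. x \<in> topspace X \<Longrightarrow>
      \<exists>U. openin X U \<and> x \<in> U \<and> continuous_map (subtopology X U) Y f"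
  shows "continuous_map X Y f"
proof -
  obtain U where U: "\<And>x. x \<in> topspace X \<Longrightarrow>
      openin X (U x) \<and> x \<in> U x \<and> continuous_map (subtopology X (U x)) Y f"
    using assms by metis
  show ?thesis
    by (rule pasting_lemma[where I = "topspace X" and T = U and f = "\<lambda>_. f"]) (use U in auto)
qed

text \<open>\<^term>\<open>M b\<close> is the minimal open neighbourhood of \<^term>\<open>b\<close>, \<^term>\<open>T b\<close> the fibre coordinate
  of a trivialisation over it, and \<^term>\<open>G b\<close> the inverse trivialisation.\<close>

locale minimal_charts =
  fixes B :: "'b topology" and E :: "'e topology" and F :: "'f topology" and p :: "'e \<Rightarrow> 'b"
    and M :: "'b \<Rightarrow> 'b set" and T :: "'b \<Rightarrow> 'e \<Rightarrow> 'f" and G :: "'b \<Rightarrow> 'b \<times> 'f \<Rightarrow> 'e"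
  assumes p: "continuous_map E B p"
    and M_open: "b \<in> topspace B \<Longrightarrow> openin B (M b)"
    and M_self: "b \<in> topspace B \<Longrightarrow> b \<in> M b"
    and M_least: "openin B U \<Longrightarrow> b \<in> U \<Longrightarrow> M b \<subseteq> U"
    and T: "b \<in> topspace B \<Longrightarrow> continuous_map (subtopology E {e \<in> topspace E. p e \<in> M b}) F (T b)"
    and G: "b \<in> topspace B \<Longrightarrow> continuous_map (prod_topology (subtopology B (M b)) F) E (G b)"
    and p_G: "b \<in> topspace B \<Longrightarrow> c \<in> M b \<Longrightarrow> f \<in> topspace F \<Longrightarrow> p (G b (c, f)) = c"
    and T_G: "b \<in> topspace B \<Longrightarrow> c \<in> M b \<Longrightarrow> f \<in> topspace F \<Longrightarrow> T b (G b (c, f)) = f"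
    and G_T: "b \<in> topspace B \<Longrightarrow> e \<in> topspace E \<Longrightarrow> p e \<in> M b \<Longrightarrow> G b (p e, T b e) = e"
begin

section \<open>Parallelism over minimal neighbourhoods\<close>

definition over :: "'b \<Rightarrow> 'e set" where
  "over b = {e \<in> topspace E. b \<in> topspace B \<and> p e \<in> M b}"

text \<open>The flat structure over \<open>M b\<close>: only fibre coordinates are compared, and the
  base points \<open>p e\<close> and \<open>p e'\<close> may differ.\<close>

definition parallel :: "'b \<Rightarrow> 'e \<Rightarrow> 'e \<Rightarrow> bool" where
  "parallel b e e' \<longleftrightarrow> e \<in> over b \<and> e' \<in> over b \<and> indistinguishable F (T b e) (T b e')"

lemma M_subset: "b \<in> topspace B \<Longrightarrow> M b \<subseteq> topspace B"
  using M_open openin_subset by blast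

lemma M_mono: "b \<in> topspace B \<Longrightarrow> c \<in> M b \<Longrightarrow> M c \<subseteq> M b"
  using M_open M_least by blast

lemma over_mono: "b \<in> topspace B \<Longrightarrow> c \<in> M b \<Longrightarrow> over c \<subseteq> over b"
  using M_mono[of b c] M_subset[of b] by (auto simp: over_def)

lemma T_in: "e \<in> over b \<Longrightarrow> T b e \<in> topspace F"
  using T[of b] by (auto simp: over_def continuous_map_def)

lemma over_self: "e \<in> topspace E \<Longrightarrow> e \<in> over (p e)"
  using p M_self by (auto simp: over_def continuous_map_def)

lemma G_over:
  assumes "b \<in> topspace B" "c \<in> M b" "f \<in> topspace F"
  shows "G b (c, f) \<in> over b"
proof -
  have "(c, f) \<in> topspace (prod_topology (subtopology B (M b)) F)"
    using assms M_subset[of b] by auto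
  then have "G b (c, f) \<in> topspace E"
    using G[OF assms(1)] unfolding continuous_map_def by blast
  then show ?thesis
    using assms p_G by (simp add: over_def)
qed

lemma parallel_refl: "e \<in> over b \<Longrightarrow> parallel b e e"
  by (simp add: parallel_def indistinguishable_refl T_in)

lemma parallel_sym: "parallel b e e' \<Longrightarrow> parallel b e' e"
  by (simp add: parallel_def indistinguishable_sym)

lemma parallel_trans: "parallel b e e' \<Longrightarrow> parallel b e' e'' \<Longrightarrow> parallel b e e''"
  by (auto simp: parallel_def intro: indistinguishable_trans)

text \<open>\<open>G b (c, T b e)\<close> is the parallel transport of \<open>e\<close> into the
  fibre over \<open>c\<close>; by \<open>T_G\<close> its fibre coordinate is that of
  \<open>e\<close> itself.\<close>

lemma parallel_G:
  assumes "e \<in> over b" "c \<in> M b"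
  shows "parallel b e (G b (c, T b e))"
  using assms G_over[of b c "T b e"] T_in[OF assms(1)] T_G[of b c "T b e"]
  by (auto simp: parallel_def over_def intro: indistinguishable_refl)

lemma specializes_T:
  assumes "specializes E e e'" "e \<in> over b" "e' \<in> over b"
  shows "specializes F (T b e) (T b e')"
proof (rule specializes_continuous_map[where f = "T b"])
  show "continuous_map (subtopology E {e \<in> topspace E. p e \<in> M b}) F (T b)"
    using assms T by (simp add: over_def)
  show "specializes (subtopology E {e \<in> topspace E. p e \<in> M b}) e e'"
    using assms by (auto simp: over_def intro: specializes_subtopology)
qed

text \<open>Since \<open>p e\<close> lies in \<open>M (p e0)\<close>, the base coordinates
  specialize automatically, so only the fibre coordinates decide. The left side does not mention
  \<open>b\<close>: specialization of fibre coordinates can therefore be carried from one chart to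
  another through \<open>E\<close>.\<close>

lemma specializes_iff_T:
  assumes b: "b \<in> topspace B" "p e0 \<in> M b" and e0: "e0 \<in> topspace E" and e: "e \<in> over (p e0)"
  shows "specializes E e0 e \<longleftrightarrow> specializes F (T b e0) (T b e)"
proof
  have over: "e0 \<in> over b" "e \<in> over b"
    using over_mono[OF b] over_self[OF e0] e by auto
  then show "specializes E e0 e \<Longrightarrow> specializes F (T b e0) (T b e)"
    by (rule specializes_T[rotated])
  assume F: "specializes F (T b e0) (T b e)"
  have "p e0 \<in> topspace B" "p e \<in> M (p e0)"
    using e by (auto simp: over_def)
  then have "specializes B (p e0) (p e)"
    using M_subset M_least unfolding specializes_def by blast
  then have "specializes (subtopology B (M b)) (p e0) (p e)"
    using over by (auto simp: over_def intro: specializes_subtopology)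
  from specializes_continuous_map[OF G[OF b(1)] specializes_prod_topology[OF this F]]
  have "specializes E (G b (p e0, T b e0)) (G b (p e, T b e))" .
  moreover have "G b (p e0, T b e0) = e0" "G b (p e, T b e) = e"
    using over by (auto simp: over_def intro: G_T)
  ultimately show "specializes E e0 e" by simp
qed

text \<open>One direction passes from the chart at \<open>p e0\<close> to the chart at
  \<open>b\<close> by \<open>specializes_iff_T\<close>. The other cannot start at \<open>e\<close>,
  because \<open>e0\<close> need not lie over \<open>M (p e)\<close>; it starts at a substitute for
  \<open>e\<close> in the fibre of \<open>e0\<close>.\<close>

lemma parallel_enlarge_base:
  assumes b: "b \<in> topspace B" "p e0 \<in> M b" and par: "parallel (p e0) e0 e"
  shows "parallel b e0 e"
proof -
  let ?c = "p e0"
  have c: "?c \<in> topspace B" using b(2) M_subset[OF b(1)] by blast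
  have e0: "e0 \<in> topspace E" and e: "e \<in> over ?c" "e0 \<in> over ?c"
    using par by (auto simp: parallel_def over_def)
  have over: "e0 \<in> over b" "e \<in> over b"
    using over_mono[OF b] e by auto
  have cc: "?c \<in> M ?c" using M_self c by simp
  have par': "specializes F (T ?c e0) (T ?c e)" "specializes F (T ?c e) (T ?c e0)"
    using par by (auto simp: parallel_def indistinguishable_def)
  then have 1: "specializes F (T b e0) (T b e)"
    using specializes_iff_T[OF b e0 e(1)] specializes_iff_T[OF c cc e0 e(1)] by simp
  \<comment> \<open>The substitute: \<open>e\<close> transported in the chart at \<open>b\<close> to
    the base point of \<open>e0\<close>. It has the same coordinate as \<open>e\<close> in that
    chart, hence specializes to \<open>e\<close>, and then to \<open>e0\<close> by the assumed
    parallelism in the chart at \<open>p e0\<close>.\<close>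
  define e1 where "e1 = G b (?c, T b e)"
  have pe1: "p e1 = ?c" and Te1: "T b e1 = T b e" and e1b: "e1 \<in> over b"
    unfolding e1_def by (intro p_G T_G G_over b T_in over)+
  have e1: "e1 \<in> topspace E" using e1b by (simp add: over_def)
  have b1: "p e1 \<in> M b" and c1: "p e1 \<in> M ?c" and oe: "e \<in> over (p e1)" and oe0: "e0 \<in> over (p e1)"
    using pe1 b cc e by auto
  have "specializes E e1 e"
    using specializes_iff_T[OF b(1) b1 e1 oe] Te1 specializes_refl[OF T_in[OF over(2)]] by simp
  then have "specializes F (T ?c e1) (T ?c e)"
    using specializes_iff_T[OF c c1 e1 oe] by simp
  then have "specializes F (T ?c e1) (T ?c e0)"
    using par'(2) by (rule specializes_trans)
  then have "specializes E e1 e0"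
    using specializes_iff_T[OF c c1 e1 oe0] by simp
  then have "specializes F (T b e) (T b e0)"
    using specializes_iff_T[OF b(1) b1 e1 oe0] Te1 by simp
  with 1 over show ?thesis
    by (simp add: parallel_def indistinguishable_def)
qed

text \<open>Transporting \<open>e\<close> to the fibre over the centre \<open>c\<close> gives a
  point parallel to both \<open>e\<close> and \<open>e'\<close>, and the preceding case applies to
  each of the two pairs.\<close>

lemma parallel_enlarge:
  assumes b: "b \<in> topspace B" "c \<in> M b" and par: "parallel c e e'"
  shows "parallel b e e'"
proof -
  have c: "c \<in> topspace B" "c \<in> M c" using b M_subset M_self by blast+
  have e: "e \<in> over c" using par by (simp add: parallel_def)
  define e0 where "e0 = G c (c, T c e)"
  have pe0: "p e0 = c" using c e T_in p_G by (simp add: e0_def)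
  have "parallel c e0 e" using parallel_G[OF e c(2)] parallel_sym by (simp add: e0_def)
  then have "parallel b e0 e" "parallel b e0 e'"
    using parallel_enlarge_base[of b e0] b pe0 par parallel_trans by metis+
  then show ?thesis
    using parallel_sym parallel_trans by blast
qed

text \<open>With a common base point each of \<open>e\<close> and \<open>e'\<close> lies over the
  minimal neighbourhood of the other's base point, so \<open>specializes_iff_T\<close> applies in
  both directions.\<close>

lemma parallel_same_base:
  assumes "parallel b e e'" "p e = p e'"
  shows "indistinguishable E e e'"
proof -
  have o: "e \<in> over b" "e' \<in> over b" and
    par: "specializes F (T b e) (T b e')" "specializes F (T b e') (T b e)"
    using assms(1) by (auto simp: parallel_def indistinguishable_def)
  have "e \<in> topspace E" "e' \<in> topspace E" "b \<in> topspace B" "p e \<in> M b" "p e' \<in> M b"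
    using o by (auto simp: over_def)
  moreover from this have "e \<in> over (p e')" "e' \<in> over (p e)"
    using over_self assms(2) by metis+
  ultimately show ?thesis
    using par specializes_iff_T unfolding indistinguishable_def by blast
qed

text \<open>A converse to \<open>parallel_enlarge\<close>. Transport \<open>e\<close> in the smaller
  chart to the base point of \<open>e'\<close>; by enlargement the result is parallel to
  \<open>e'\<close> over \<open>b\<close>, hence indistinguishable from it, and the smaller chart
  cannot separate the two.\<close>

lemma parallel_restrict:
  assumes b: "b \<in> topspace B" "c \<in> M b" and par: "parallel b e e'" and e: "e \<in> over c" "e' \<in> over c"
  shows "parallel c e e'"
proof -
  have pe': "p e' \<in> M c" using e by (simp add: over_def)
  define e2 where "e2 = G c (p e', T c e)"
  have par2: "parallel c e e2" using parallel_G[OF e(1) pe'] by (simp add: e2_def)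
  then have "parallel b e' e2"
    using parallel_enlarge[OF b] par parallel_sym parallel_trans by blast
  moreover have "p e2 = p e'"
    using e pe' T_in p_G by (auto simp: e2_def over_def)
  ultimately have "indistinguishable E e2 e'"
    using parallel_same_base indistinguishable_sym by metis
  then have "parallel c e2 e'"
    using par2 e unfolding parallel_def indistinguishable_def by (auto intro: specializes_T)
  then show ?thesis
    using par2 parallel_trans by blast
qed

section \<open>Horizontal paths and their existence\<close>

text \<open>At time \<open>t\<close> the chart at \<open>p (k t)\<close> is used, so no choice of
  charts enters. As \<open>parallel\<close> places \<open>k s\<close> over
  \<open>M (p (k t))\<close>, continuity of the projected path on \<open>S\<close> is built
  in.\<close>

definition horizontal :: "(real \<Rightarrow> 'e) \<Rightarrow> real set \<Rightarrow> bool" where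
  "horizontal k S \<longleftrightarrow> (\<forall>t\<in>S. k t \<in> topspace E \<and>
     (\<exists>J. open J \<and> t \<in> J \<and> (\<forall>s\<in>J \<inter> S. parallel (p (k t)) (k t) (k s))))"

lemma horizontal_topspace: "horizontal k S \<Longrightarrow> t \<in> S \<Longrightarrow> k t \<in> topspace E"
  by (simp add: horizontal_def)

lemma horizontal_nbhd:
  assumes "horizontal k S" "t \<in> S"
  obtains J where "open J" "t \<in> J" "\<And>s. s \<in> J \<inter> S \<Longrightarrow> parallel (p (k t)) (k t) (k s)"
  using assms unfolding horizontal_def by metis

lemma horizontal_subset: "horizontal k S \<Longrightarrow> S' \<subseteq> S \<Longrightarrow> horizontal k S'"
  unfolding horizontal_def by (meson IntE IntI subsetD)

text \<open>Parallelism in the small charts along the path enlarges to the chart at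
  \<open>b\<close>, so being parallel to \<open>k s\<close> there is a locally constant property on
  the connected set \<open>J\<close>.\<close>

lemma horizontal_parallel:
  assumes k: "horizontal k S" and J: "connected J" "J \<subseteq> S" and b: "b \<in> topspace B"
    and M: "\<And>s. s \<in> J \<Longrightarrow> p (k s) \<in> M b" and st: "s \<in> J" "t \<in> J"
  shows "parallel b (k s) (k t)"
proof (rule connected_induction_simple[OF J(1), where P = "\<lambda>t. parallel b (k s) (k t)" and a = s])
  show "parallel b (k s) (k s)"
    using horizontal_topspace[OF k] J b M st by (intro parallel_refl) (auto simp: over_def)
  fix a assume a: "a \<in> J"
  then obtain U where U: "open U" "a \<in> U" "\<And>r. r \<in> U \<inter> S \<Longrightarrow> parallel (p (k a)) (k a) (k r)"
    using J horizontal_nbhd[OF k] by blast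
  have "parallel b (k a) (k r)" if "r \<in> J \<inter> U" for r
    using parallel_enlarge[OF b M[OF a] U(3)] that J by blast
  then have "\<forall>x\<in>J \<inter> U. \<forall>y\<in>J \<inter> U. parallel b (k s) (k x) \<longrightarrow> parallel b (k s) (k y)"
    using parallel_sym parallel_trans by meson
  then show "\<exists>T. openin (top_of_set J) T \<and> a \<in> T \<and>
      (\<forall>x\<in>T. \<forall>y\<in>T. parallel b (k s) (k x) \<longrightarrow> parallel b (k s) (k y))"
    using a U by (intro exI[of _ "J \<inter> U"]) auto
qed (use st in auto)

text \<open>Beyond \<open>r\<close> the path continues with constant fibre coordinate in the chart
  at \<open>b\<close>; \<open>parallel_restrict\<close> turns this into horizontality in the chart
  at each \<open>\<gamma> t\<close>.\<close>

lemma horizontal_extend: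
  assumes \<gamma>: "continuous_map (top_of_set {0..1}) B \<gamma>"
    and rs: "0 \<le> r" "r \<le> s" "s \<le> 1"
    and b: "b \<in> topspace B" "\<And>u. u \<in> {r..s} \<Longrightarrow> \<gamma> u \<in> M b"
    and k: "horizontal k {0..r}" "\<And>u. u \<in> {0..r} \<Longrightarrow> p (k u) = \<gamma> u"
  shows "\<exists>k'. k' 0 = k 0 \<and> horizontal k' {0..s} \<and> (\<forall>u\<in>{0..s}. p (k' u) = \<gamma> u)"
proof -
  have kr: "k r \<in> over b"
    using horizontal_topspace[OF k(1), of r] k(2)[of r] b rs by (simp add: over_def)
  \<comment> \<open>The second branch transports \<open>k r\<close> along \<open>\<gamma>\<close>;
    at \<open>u = r\<close> it would return \<open>k r\<close> by \<open>G_T\<close>, so the two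
    pieces fit.\<close>
  define k' where "k' u = (if u \<le> r then k u else G b (\<gamma> u, T b (k r)))" for u
  have pk': "p (k' u) = \<gamma> u" if "u \<in> {0..s}" for u
    using that k(2) b p_G T_in[OF kr] by (auto simp: k'_def)
  have par_r: "parallel b (k r) (k' u)" if "u \<in> {r..s}" for u
    using that parallel_refl[OF kr] parallel_G[OF kr] b by (auto simp: k'_def)
  have par: "parallel b (k' u) (k' v)" if "u \<in> {r..s}" "v \<in> {r..s}" for u v
    using par_r[OF that(1)] par_r[OF that(2)] parallel_sym parallel_trans by blast
  have in_E: "k' u \<in> topspace E" if "u \<in> {0..s}" for u
  proof (cases "u \<le> r")
    case True
    then show ?thesis using that horizontal_topspace[OF k(1), of u] by (simp add: k'_def)
  next
    case False
    then have "parallel b (k r) (k' u)" using that by (intro par_r) auto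
    then show ?thesis by (auto simp: parallel_def over_def)
  qed
  have \<gamma>B: "\<gamma> t \<in> topspace B" if "t \<in> {0..s}" for t
    using that \<gamma> rs by (auto simp: continuous_map_def)
  \<comment> \<open>Continuity of \<open>\<gamma>\<close> keeps nearby points over
    \<open>M (\<gamma> t)\<close>, which \<open>parallel_restrict\<close> demands of both of its
    points.\<close>
  have nbhd: "\<exists>J. open J \<and> t \<in> J \<and> (\<forall>u\<in>J \<inter> {0..s}. \<gamma> u \<in> M (\<gamma> t))" if t: "t \<in> {0..s}" for t
  proof -
    have "openin (top_of_set {0..1}) {u \<in> {0..1}. \<gamma> u \<in> M (\<gamma> t)}"
      using openin_continuous_map_preimage[OF \<gamma> M_open[OF \<gamma>B[OF t]]] by simp
    then obtain J where J: "open J" "{u \<in> {0..1}. \<gamma> u \<in> M (\<gamma> t)} = {0..1} \<inter> J"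
      by (auto simp: openin_open)
    have J_iff: "u \<in> J \<longleftrightarrow> \<gamma> u \<in> M (\<gamma> t)" if "u \<in> {0..s}" for u
      using eqset_imp_iff[OF J(2), of u] that rs by auto
    show ?thesis
      using J(1) J_iff t M_self[OF \<gamma>B[OF t]] by (intro exI[of _ J]) auto
  qed
  have right: "\<exists>J. open J \<and> t \<in> J \<and> (\<forall>u\<in>J \<inter> {r..s}. parallel (p (k' t)) (k' t) (k' u))"
    if t: "t \<in> {r..s}" for t
  proof -
    have t0: "t \<in> {0..s}" using t rs by auto
    obtain J where J: "open J" "t \<in> J" "\<And>u. u \<in> J \<inter> {0..s} \<Longrightarrow> \<gamma> u \<in> M (\<gamma> t)"
      using nbhd[OF t0] by blast
    have "parallel (p (k' t)) (k' t) (k' u)" if u: "u \<in> J \<inter> {r..s}" for u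
    proof (rule parallel_restrict[OF b(1)])
      have u0: "u \<in> {0..s}" using u rs by auto
      show "p (k' t) \<in> M b" using pk'[OF t0] b t by simp
      show "parallel b (k' t) (k' u)" using par t u by blast
      show "k' t \<in> over (p (k' t))" using over_self in_E t0 by blast
      show "k' u \<in> over (p (k' t))"
        using in_E[OF u0] pk'[OF u0] pk'[OF t0] \<gamma>B[OF t0] J(3)[of u] u u0
        by (simp add: over_def)
    qed
    then show ?thesis using J by blast
  qed
  have left: "\<exists>J. open J \<and> t \<in> J \<and> (\<forall>u\<in>J \<inter> {0..r}. parallel (p (k' t)) (k' t) (k' u))"
    if t: "t \<in> {0..r}" for t
    by (rule horizontal_nbhd[OF k(1) t]) (use t in \<open>force simp: k'_def\<close>)
  have "\<exists>J. open J \<and> t \<in> J \<and> (\<forall>u\<in>J \<inter> {0..s}. parallel (p (k' t)) (k' t) (k' u))"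
    if t: "t \<in> {0..s}" for t
  proof -
    \<comment> \<open>Away from \<open>r\<close> a neighbourhood on one side of \<open>r\<close>
      suffices; at the junction the left and right neighbourhoods are intersected.\<close>
    consider "t < r" | "t = r" | "t > r" by linarith
    then show ?thesis
    proof cases
      case 1
      with t left[of t] obtain J where
        "open J" "t \<in> J" "\<forall>u\<in>J \<inter> {0..r}. parallel (p (k' t)) (k' t) (k' u)" by auto
      with 1 show ?thesis by (intro exI[of _ "J \<inter> {..<r}"]) (auto simp: open_Int)
    next
      case 2
      with t left[of t] right[of t] obtain J J' where
        "open J" "t \<in> J" "\<forall>u\<in>J \<inter> {0..r}. parallel (p (k' t)) (k' t) (k' u)"
        "open J'" "t \<in> J'" "\<forall>u\<in>J' \<inter> {r..s}. parallel (p (k' t)) (k' t) (k' u)" by auto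
      then show ?thesis by (intro exI[of _ "J \<inter> J'"]) (fastforce simp: open_Int)
    next
      case 3
      with t right[of t] obtain J where
        "open J" "t \<in> J" "\<forall>u\<in>J \<inter> {r..s}. parallel (p (k' t)) (k' t) (k' u)" by auto
      with 3 show ?thesis by (intro exI[of _ "J \<inter> {r<..}"]) (auto simp: open_Int)
    qed
  qed
  then have "horizontal k' {0..s}"
    using in_E by (simp add: horizontal_def)
  then show ?thesis
    using pk' rs by (intro exI[of _ k']) (auto simp: k'_def)
qed

text \<open>Connectedness of the interval replaces a finite subdivision: liftability over
  \<open>{0..r}\<close> is locally constant in \<open>r\<close> and holds at
  \<open>r = 0\<close>.\<close>

lemma horizontal_lift_exists:
  assumes \<gamma>: "continuous_map (top_of_set {0..1}) B \<gamma>" and e: "e \<in> topspace E" "p e = \<gamma> 0"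
  shows "\<exists>k. k 0 = e \<and> horizontal k {0..1} \<and> (\<forall>u\<in>{0..1}. p (k u) = \<gamma> u)"
proof -
  let ?P = "\<lambda>r. \<exists>k. k 0 = e \<and> horizontal k {0..r} \<and> (\<forall>u\<in>{0..r}. p (k u) = \<gamma> u)"
  have "?P 1"
  proof (rule connected_induction_simple[where S = "{0..1::real}" and a = 0])
    show "?P 0"
    proof (intro exI conjI)
      show "horizontal (\<lambda>_. e) {0..0}"
        unfolding horizontal_def using e parallel_refl[OF over_self] open_UNIV by blast
    qed (use e in auto)
    fix t :: real assume t: "t \<in> {0..1}"
    then have \<gamma>t: "\<gamma> t \<in> topspace B"
      using \<gamma> by (auto simp: continuous_map_def)
    let ?V = "{u \<in> {0..1}. \<gamma> u \<in> M (\<gamma> t)}"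
    have "openin (top_of_set {0..1}) ?V"
      using openin_continuous_map_preimage[OF \<gamma> M_open[OF \<gamma>t]] by simp
    moreover have "t \<in> ?V" using t M_self[OF \<gamma>t] by simp
    ultimately obtain d where d: "d > 0" "ball t d \<inter> {0..1} \<subseteq> ?V"
      unfolding openin_contains_ball by blast
    \<comment> \<open>Moving right extends the lift inside the single chart at
      \<open>\<gamma> t\<close>; moving left merely restricts it.\<close>
    have step: "?P y" if x: "x \<in> {0..1} \<inter> ball t d" and y: "y \<in> {0..1} \<inter> ball t d" and Px: "?P x" for x y
    proof (cases "x \<le> y")
      case True
      from Px obtain k where k: "k 0 = e" "horizontal k {0..x}" "\<And>u. u \<in> {0..x} \<Longrightarrow> p (k u) = \<gamma> u"
        by auto
      have "\<gamma> u \<in> M (\<gamma> t)" if "u \<in> {x..y}" for u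
      proof -
        have "u \<in> ball t d \<inter> {0..1}" using that x y by (auto simp: dist_real_def)
        then show ?thesis using d by blast
      qed
      from horizontal_extend[OF \<gamma> _ True _ \<gamma>t this k(2,3)] show ?thesis
        using x y k(1) by auto
    next
      case False
      then have sub: "{0..y} \<subseteq> {0..x}" by auto
      from Px obtain k where k: "k 0 = e" "horizontal k {0..x}" "\<forall>u\<in>{0..x}. p (k u) = \<gamma> u"
        by auto
      with sub horizontal_subset[OF k(2) sub] show ?thesis by blast
    qed
    show "\<exists>T. openin (top_of_set {0..1}) T \<and> t \<in> T \<and> (\<forall>x\<in>T. \<forall>y\<in>T. ?P x \<longrightarrow> ?P y)"
    proof (rule exI, rule conjI[OF _ conjI])
      show "openin (top_of_set {0..1}) ({0..1} \<inter> ball t d)" by auto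
      show "t \<in> {0..1} \<inter> ball t d" using t d(1) by simp
    qed (rule ballI, rule ballI, rule impI, rule step)
  qed auto
  then show ?thesis .
qed

section \<open>Continuity of lifted homotopies\<close>

text \<open>On a small box around \<open>(t, x)\<close>, \<open>K\<close> is indistinguishable from
  the transport of any one of its time slices. Continuity of one slice near \<open>x\<close> thus
  yields continuity on a box, and it spreads along the interval from time 0.\<close>

lemma continuous_map_horizontal_lift:
  fixes X :: "'x topology"
  assumes H: "continuous_map (prod_topology (top_of_set {0..1}) X) B H"
    and K: "\<And>x. x \<in> topspace X \<Longrightarrow> horizontal (\<lambda>t. K (t, x)) {0..1}"
    and pK: "\<And>t x. t \<in> {0..1} \<Longrightarrow> x \<in> topspace X \<Longrightarrow> p (K (t, x)) = H (t, x)"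
    and K0: "continuous_map X E (\<lambda>x. K (0, x))"
  shows "continuous_map (prod_topology (top_of_set {0..1}) X) E K"
proof (rule continuous_map_local)
  let ?I = "top_of_set {0..1::real}"
  fix z assume "z \<in> topspace (prod_topology ?I X)"
  then obtain t0 x where z: "z = (t0, x)" and t0: "t0 \<in> {0..1}" and x: "x \<in> topspace X"
    by auto
  let ?Q = "\<lambda>t. \<exists>N. openin X N \<and> x \<in> N \<and> continuous_map (subtopology X N) E (\<lambda>y. K (t, y))"
  \<comment> \<open>\<open>J\<close> and \<open>N\<close> are fixed before \<open>s\<close> and
    \<open>N'\<close>, so any slice with time in \<open>J\<close> can serve as the seed for all
    other times in \<open>J\<close>.\<close>
  have box: "\<exists>J N. openin ?I J \<and> t \<in> J \<and> openin X N \<and> x \<in> N \<and>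
      (\<forall>s\<in>J. \<forall>N'. openin X N' \<longrightarrow> continuous_map (subtopology X N') E (\<lambda>y. K (s, y)) \<longrightarrow>
        continuous_map (subtopology (prod_topology ?I X) (J \<times> (N \<inter> N'))) E K)"
    if t: "t \<in> {0..1}" for t
  proof -
    define b where "b = H (t, x)"
    have b: "b \<in> topspace B"
      using H t x unfolding b_def continuous_map_def by auto
    let ?W = "{z \<in> topspace (prod_topology ?I X). H z \<in> M b}"
    have "openin (prod_topology ?I X) ?W"
      using openin_continuous_map_preimage[OF H M_open[OF b]] .
    moreover have "(t, x) \<in> ?W"
      using t x M_self[OF b] by (simp add: b_def)
    ultimately obtain J0 N where J0: "openin ?I J0" "t \<in> J0" and N: "openin X N" "x \<in> N"
      and JN: "J0 \<times> N \<subseteq> ?W"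
      by (rule openin_prod_topology_box)
    from J0 obtain d where d: "d > 0" "ball t d \<inter> {0..1} \<subseteq> J0"
      unfolding openin_contains_ball by blast
    \<comment> \<open>Passing to a ball makes the time set connected, as
      \<open>horizontal_parallel\<close> requires.\<close>
    define J where "J = {0..1} \<inter> ball t d"
    have J: "openin ?I J" "t \<in> J" "J \<subseteq> {0..1}" "J \<subseteq> J0"
      using t d by (auto simp: J_def)
    have connJ: "connected J"
      unfolding J_def by (intro convex_connected convex_Int) auto
    have HM: "H (s, y) \<in> M b" if "s \<in> J" "y \<in> N" for s y
      using JN J that by blast
    have slab: "continuous_map (subtopology (prod_topology ?I X) (J \<times> (N \<inter> N'))) E K"
      if s: "s \<in> J" and N': "openin X N'"
        and cont: "continuous_map (subtopology X N') E (\<lambda>y. K (s, y))" for s N'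
    proof -
      let ?D = "subtopology (prod_topology ?I X) (J \<times> (N \<inter> N'))"
      have topD: "topspace ?D = J \<times> (N \<inter> N')"
        using J(3) openin_subset[OF N(1)] by auto
      have NX: "N \<subseteq> topspace X" using openin_subset[OF N(1)] .
      have Kover: "K (r, y) \<in> over b" if "r \<in> J" "y \<in> N" for r y
      proof -
        have "r \<in> {0..1}" "y \<in> topspace X" using that NX J(3) by auto
        then show ?thesis
          using HM[OF that] pK[of r y] horizontal_topspace[OF K[of y], of r] b by (simp add: over_def)
      qed
      \<comment> \<open>The comparison map: the slice at time \<open>s\<close>, transported in the
        chart at \<open>b\<close> to the base point \<open>H z\<close>. It is continuous as a
        composite of continuous maps.\<close>
      define K' where "K' z = G b (H z, T b (K (s, snd z)))" for z
      have "continuous_map ?D (subtopology X N') snd"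
        by (auto simp: continuous_map_in_subtopology topD
            intro!: continuous_map_from_subtopology continuous_map_snd)
      from continuous_map_compose[OF this cont]
      have "continuous_map ?D E (\<lambda>z. K (s, snd z))" by (simp add: o_def)
      then have "continuous_map ?D (subtopology E {e \<in> topspace E. p e \<in> M b}) (\<lambda>z. K (s, snd z))"
        using Kover[OF s] by (auto simp: continuous_map_in_subtopology topD over_def)
      from continuous_map_compose[OF this T[OF b]]
      have "continuous_map ?D F (\<lambda>z. T b (K (s, snd z)))" by (simp add: o_def)
      moreover have "continuous_map ?D (subtopology B (M b)) H"
        using HM H by (auto simp: continuous_map_in_subtopology topD
            intro!: continuous_map_from_subtopology)
      ultimately have "continuous_map ?D (prod_topology (subtopology B (M b)) F)
          (\<lambda>z. (H z, T b (K (s, snd z))))"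
        by (simp add: continuous_map_pairedI)
      from continuous_map_compose[OF this G[OF b]]
      have K': "continuous_map ?D E K'" by (simp add: o_def K'_def[abs_def])
      show ?thesis
      proof (rule continuous_map_indistinguishable[OF K'])
        fix z assume "z \<in> topspace ?D"
        then obtain r y where ry: "z = (r, y)" "r \<in> J" "y \<in> N" "y \<in> topspace X"
          using topD NX by auto
        \<comment> \<open>\<open>K z\<close> and \<open>K' z\<close> are both parallel to the seed
          \<open>K (s, y)\<close> and lie over the same base point \<open>H z\<close>.\<close>
        have "parallel b (K (s, y)) (K (r, y))"
        proof (rule horizontal_parallel[OF K[OF ry(4)] connJ J(3) b _ s ry(2)])
          show "p (K (u, y)) \<in> M b" if "u \<in> J" for u
            using HM[OF that ry(3)] pK[OF subsetD[OF J(3) that] ry(4)] by simp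
        qed
        moreover have "parallel b (K (s, y)) (K' z)"
          using parallel_G[OF Kover[OF s ry(3)] HM[OF ry(2,3)]] ry by (simp add: K'_def)
        ultimately have "parallel b (K' z) (K z)"
          using ry parallel_sym parallel_trans by blast
        moreover have "p (K' z) = p (K z)"
          using p_G[OF b HM[OF ry(2,3)] T_in[OF Kover[OF s ry(3)]]]
            pK[OF subsetD[OF J(3) ry(2)] ry(4)] ry(1)
          by (simp add: K'_def)
        ultimately show "indistinguishable E (K' z) (K z)"
          by (rule parallel_same_base)
      qed
    qed
    show ?thesis
      by (intro exI conjI ballI allI impI; (rule J N | rule slab; assumption))
  qed
  have "?Q t0"
  proof (rule connected_induction_simple[where S = "{0..1::real}" and a = 0])
    show "?Q 0"
      using K0 x by (intro exI[of _ "topspace X"]) auto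
    fix t :: real assume t: "t \<in> {0..1}"
    obtain J N where J: "openin ?I J" "t \<in> J" and N: "openin X N" "x \<in> N"
      and JN: "\<And>s N'. s \<in> J \<Longrightarrow> openin X N' \<Longrightarrow>
        continuous_map (subtopology X N') E (\<lambda>y. K (s, y)) \<Longrightarrow>
        continuous_map (subtopology (prod_topology ?I X) (J \<times> (N \<inter> N'))) E K"
      using box[OF t] by blast
    have step: "?Q s'" if s: "s \<in> J" "s' \<in> J" and Qs: "?Q s" for s s'
    proof -
      obtain N' where N': "openin X N'" "x \<in> N'" "continuous_map (subtopology X N') E (\<lambda>y. K (s, y))"
        using Qs by blast
      \<comment> \<open>Inserting the constant time \<open>s'\<close> restricts the continuous map
        on the slab to the slice at \<open>s'\<close>.\<close>
      have "continuous_map (subtopology X (N \<inter> N')) (subtopology (prod_topology ?I X) (J \<times> (N \<inter> N')))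
          (\<lambda>y. (s', y))"
        using s openin_subset[OF J(1)]
        by (auto simp: continuous_map_in_subtopology intro!: continuous_map_pairedI
            continuous_map_from_subtopology)
      from continuous_map_compose[OF this JN[OF s(1) N'(1,3)]]
      show ?thesis
        using N N' by (intro exI[of _ "N \<inter> N'"]) (auto simp: o_def)
    qed
    show "\<exists>T. openin ?I T \<and> t \<in> T \<and> (\<forall>x\<in>T. \<forall>y\<in>T. ?Q x \<longrightarrow> ?Q y)"
      by (rule exI, rule conjI[OF J(1) conjI[OF J(2)]], rule ballI, rule ballI, rule impI, rule step)
  qed (use t0 in auto)
  then obtain N' where N': "openin X N'" "x \<in> N'" "continuous_map (subtopology X N') E (\<lambda>y. K (t0, y))"
    by blast
  obtain J N where J: "openin ?I J" "t0 \<in> J" and N: "openin X N" "x \<in> N"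
    and JN: "continuous_map (subtopology (prod_topology ?I X) (J \<times> (N \<inter> N'))) E K"
    using box[OF t0] N' by blast
  show "\<exists>U. openin (prod_topology ?I X) U \<and> z \<in> U \<and>
      continuous_map (subtopology (prod_topology ?I X) U) E K"
    using J N N' JN z by (intro exI[of _ "J \<times> (N \<inter> N')"]) (auto simp: openin_prod_Times_iff)
qed

text \<open>The lifts of the paths \<open>H (u, x)\<close> are chosen independently for each
  \<open>x\<close>; only their initial values, given by \<open>f\<close>, are known to vary
  continuously, and \<open>continuous_map_horizontal_lift\<close> supplies the rest.\<close>

lemma homotopy_lifting:
  fixes X :: "'x topology"
  shows "homotopy_lifting_property X E B p"
  unfolding homotopy_lifting_property_def
proof (intro allI impI)
  fix H :: "real \<times> 'x \<Rightarrow> 'b" and f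
  assume "continuous_map (prod_topology (top_of_set {0..1}) X) B H \<and>
    continuous_map X E f \<and> (\<forall>x\<in>topspace X. p (f x) = H (0, x))"
  then have H: "continuous_map (prod_topology (top_of_set {0..1}) X) B H"
    and f: "continuous_map X E f" and pf: "\<And>x. x \<in> topspace X \<Longrightarrow> p (f x) = H (0, x)"
    by auto
  have "\<exists>k. k 0 = f x \<and> horizontal k {0..1} \<and> (\<forall>u\<in>{0..1}. p (k u) = H (u, x))"
    if x: "x \<in> topspace X" for x
  proof (rule horizontal_lift_exists)
    have "continuous_map (top_of_set {0..1}) (prod_topology (top_of_set {0..1}) X) (\<lambda>u::real. (u, x))"
      using x by (intro continuous_map_pairedI) auto
    from continuous_map_compose[OF this H]
    show "continuous_map (top_of_set {0..1}) B (\<lambda>u. H (u, x))" by (simp add: o_def)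
    show "f x \<in> topspace E" using f x by (auto simp: continuous_map_def)
  qed (use pf x in auto)
  then obtain k where k: "\<And>x. x \<in> topspace X \<Longrightarrow>
      k x 0 = f x \<and> horizontal (k x) {0..1} \<and> (\<forall>u\<in>{0..1}. p (k x u) = H (u, x))"
    by metis
  define K where "K z = k (snd z) (fst z)" for z
  have "continuous_map (prod_topology (top_of_set {0..1}) X) E K"
  proof (rule continuous_map_horizontal_lift[OF H])
    show "continuous_map X E (\<lambda>x. K (0, x))"
      using continuous_map_eq[OF f] k by (simp add: K_def)
  qed (use k in \<open>auto simp: K_def\<close>)
  then show "\<exists>K. continuous_map (prod_topology (top_of_set {0..1}) X) E K \<and>
      (\<forall>t\<in>{0..1}. \<forall>x\<in>topspace X. p (K (t, x)) = H (t, x)) \<and> (\<forall>x\<in>topspace X. K (0, x) = f x)"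
    using k by (intro exI[of _ K]) (auto simp: K_def)
qed

end

section \<open>Minimal charts of a bundle over an Alexandroff space\<close>

text \<open>The Alexandroff property makes the intersection of all open neighbourhoods of a point
  open, and a trivialisation over any neighbourhood \<open>U\<close> of \<open>b\<close> restricts
  to \<open>M b\<close>.\<close>

lemma fiber_bundle_minimal_charts:
  fixes B :: "'b topology" and E :: "'e topology" and F :: "'f topology" and p :: "'e \<Rightarrow> 'b"
  assumes "alexandroff_space B" and fib: "fiber_bundle F E B p"
  obtains M T G where "minimal_charts B E F p M T G"
proof -
  have p: "continuous_map E B p" using fib by (simp add: fiber_bundle_def)
  \<comment> \<open>For \<open>b\<close> outside \<open>topspace B\<close> the family is empty and
    \<open>M b\<close> is \<open>topspace B\<close>, so openness holds for every
    \<open>b\<close>.\<close>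
  define M where "M b = topspace B \<inter> \<Inter>{U. openin B U \<and> b \<in> U}" for b
  have M_open: "openin B (M b)" for b
    unfolding M_def by (rule assms(1)[unfolded alexandroff_space_def, rule_format]) simp
  have M_self: "b \<in> M b" if "b \<in> topspace B" for b
    using that by (simp add: M_def)
  have M_least: "M b \<subseteq> U" if "openin B U" "b \<in> U" for b U
    using that by (auto simp: M_def)
  define chart where "chart b T G \<longleftrightarrow>
      continuous_map (subtopology E {e \<in> topspace E. p e \<in> M b}) F T \<and>
      continuous_map (prod_topology (subtopology B (M b)) F) E G \<and>
      (\<forall>c f. c \<in> M b \<longrightarrow> f \<in> topspace F \<longrightarrow> p (G (c, f)) = c \<and> T (G (c, f)) = f) \<and>
      (\<forall>e\<in>topspace E. p e \<in> M b \<longrightarrow> G (p e, T e) = e)" for b T G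
  have "\<exists>T G. chart b T G"
    if b: "b \<in> topspace B" for b
  proof -
    obtain U h where U: "openin B U" "b \<in> U"
      and h: "homeomorphic_map (subtopology E {e \<in> topspace E. p e \<in> U})
        (prod_topology (subtopology B U) F) h"
      and fst_h: "\<And>e. e \<in> topspace E \<Longrightarrow> p e \<in> U \<Longrightarrow> fst (h e) = p e"
      using fib b unfolding fiber_bundle_def by blast
    let ?EU = "subtopology E {e \<in> topspace E. p e \<in> U}"
    let ?BU = "prod_topology (subtopology B U) F"
    obtain g where h: "continuous_map ?EU ?BU h" and g: "continuous_map ?BU ?EU g"
      and gh: "\<And>e. e \<in> topspace ?EU \<Longrightarrow> g (h e) = e" and hg: "\<And>y. y \<in> topspace ?BU \<Longrightarrow> h (g y) = y"
      using h unfolding homeomorphic_map_maps homeomorphic_maps_def by blast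
    have MU: "M b \<subseteq> U" and MB: "M b \<subseteq> topspace B"
      using M_least U by (auto simp: M_def)
    show ?thesis
      unfolding chart_def
    proof (intro exI conjI ballI allI impI)
      have "continuous_map ?EU F (snd \<circ> h)"
        using h continuous_map_compose continuous_map_snd by blast
      then show "continuous_map (subtopology E {e \<in> topspace E. p e \<in> M b}) F (snd \<circ> h)"
        by (rule continuous_map_from_subtopology_mono) (use MU in auto)
      \<comment> \<open>The inverse trivialisation is restricted by precomposing \<open>g\<close>
        with the inclusion of \<open>M b\<close> into \<open>U\<close>.\<close>
      have "continuous_map (subtopology B (M b)) (subtopology B U) id"
        using MU MB by (auto simp: continuous_map_in_subtopology)
      then have "continuous_map (prod_topology (subtopology B (M b)) F) (subtopology B U) fst"
        using continuous_map_compose[OF continuous_map_fst] by fastforce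
      then have "continuous_map (prod_topology (subtopology B (M b)) F) ?BU (\<lambda>z. (fst z, snd z))"
        by (intro continuous_map_pairedI continuous_map_snd)
      from continuous_map_compose[OF this g]
      show "continuous_map (prod_topology (subtopology B (M b)) F) E g"
        by (simp add: continuous_map_in_subtopology o_def)
    next
      fix c f assume c: "c \<in> M b" "f \<in> topspace F"
      then have cf: "(c, f) \<in> topspace ?BU" using MU MB by auto
      then have "g (c, f) \<in> topspace ?EU" using g unfolding continuous_map_def by blast
      then show "p (g (c, f)) = c" "(snd \<circ> h) (g (c, f)) = f"
        using hg[OF cf] fst_h[of "g (c, f)"] by auto
    next
      fix e assume e: "e \<in> topspace E" "p e \<in> M b"
      \<comment> \<open>Compatibility of \<open>h\<close> with the projections identifies
        \<open>(p e, snd (h e))\<close> with \<open>h e\<close>, which \<open>g\<close> sends back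
        to \<open>e\<close>.\<close>
      then have "h e = (p e, snd (h e))" using fst_h MU by (metis prod.collapse subsetD)
      then show "g (p e, (snd \<circ> h) e) = e"
        using gh[of e] e MU by auto
    qed
  qed
  then obtain T G where TG: "chart b (T b) (G b)" if "b \<in> topspace B" for b
    by metis
  have "minimal_charts B E F p M T G"
    by (rule minimal_charts.intro) (use TG p M_open M_self M_least in \<open>simp_all add: chart_def\<close>)
  then show ?thesis by (rule that)
qed

theorem theorem6p2:
  fixes B :: "'b topology" and E :: "'e topology" and F :: "'f topology"
    and p :: "'e \<Rightarrow> 'b"
  assumes "alexandroff_space B"
    and "fiber_bundle F E B p"
  shows "hurewicz_fibration TYPE('x) E B p"
proof -
  obtain M T G where "minimal_charts B E F p M T G"
    using fiber_bundle_minimal_charts[OF assms] .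
  then interpret minimal_charts B E F p M T G .
  show ?thesis
    unfolding hurewicz_fibration_def using p homotopy_lifting by blast
qed

end
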